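(* For every $\alpha\in(0,1)$ there exist constants $a,b>0$ such that $$a\sqrt{t}<\beta_t<b\sqrt{t}\qquad\text{for all } t,$$ where $\beta_t$ is the boundary location at time $t$ of the process Frozen-Boundary Diffusion with parameter $\alpha$.
   Context: Fix $\alpha\in(0,1)$. Frozen-Boundary Diffusion with parameter $\alpha$ is the deterministic sequence $(\mu_t)_{t=0,1,2,\ldots}$ of symmetric probability distributions on $\mathbb{Z}$ defined recursively as follows. Let $\mu_0=\delta(0)$ be the unit point mass at $0$. Given $\mu_t$, the boundary is $$\beta_t:=\sup\{x\in\mathbb{Z}:\ \mu_t([x,\infty))\ge \tfrac{\alpha}{2}\}.$$ The frozen mass $f_t$ consists of the leftmost mass $\alpha/2$ and the rightmost mass $\alpha/2$ of $\mu_t$. Explicitly, if $\beta_t>0$, then for $y\ge 0$ $$f_t(y)=\begin{cases}\mu_t(y), & y>\beta_t,\\ \frac{\alpha}{2}-\sum_{z>\beta_t}\mu_t(z), & y=\beta_t,\\ 0, & 0\le y<\beta_t,\end{cases}$$ and $f_t(y)=f_t(-y)$ for $y<0$. If $\beta_t=0$, then $f_t(y)=\mu_t(y)$ for $y\neq 0$ and $f_t(0)=\alpha-2\sum_{z>0}\mu_t(z)$ (contributions from both sides). Thus $f_t$ has total mass $\alpha$. The free mass is $\nu_t:=\mu_t-f_t$, of total mass $1-\alpha$. The next distribution is $$\mu_{t+1}(x)=\frac{\nu_t(x-1)+\nu_t(x+1)}{2}+f_t(x),\qquad x\in\mathbb{Z}.$$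
   Formalization: "For all t" fails at t = 0 (β_0 = 0) and, for α > 1/2, also at t = 1 (β_1 = 0); instead there is a time T, depending on α, with β_t = 0 for all t < T and both bounds for all t ≥ T. *)

theory Defs
  imports "HOL-Analysis.Infinite_Sum"
begin

text \<open>
  A distribution on the integers is represented by its point masses, a function
  \<^typ>\<open>int \<Rightarrow> real\<close>. All distributions that occur below have finite support, so the
  infinite sums are genuine.
\<close>

definition boundary :: "real \<Rightarrow> (int \<Rightarrow> real) \<Rightarrow> int" where
  "boundary \<alpha> m = Sup {x. (\<Sum>\<^sub>\<infinity>y\<in>{x..}. m y) \<ge> \<alpha> / 2}"

text \<open>
  The boundary of a symmetric probability distribution is nonnegative when \<open>0 < \<alpha> < 1\<close>, so
  the last case split below is on a boundary equal to \<open>0\<close>.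
\<close>

definition frozen :: "real \<Rightarrow> (int \<Rightarrow> real) \<Rightarrow> int \<Rightarrow> real" where
  "frozen \<alpha> m y =
    (let b = boundary \<alpha> m in
     if b > 0 then
       if \<bar>y\<bar> > b then m \<bar>y\<bar>
       else if \<bar>y\<bar> = b then \<alpha> / 2 - (\<Sum>\<^sub>\<infinity>z\<in>{b<..}. m z)
       else 0
     else
       if y \<noteq> 0 then m y
       else \<alpha> - 2 * (\<Sum>\<^sub>\<infinity>z\<in>{0<..}. m z))"

definition free :: "real \<Rightarrow> (int \<Rightarrow> real) \<Rightarrow> int \<Rightarrow> real" where
  "free \<alpha> m x = m x - frozen \<alpha> m x"

primrec fbd :: "real \<Rightarrow> nat \<Rightarrow> int \<Rightarrow> real" where
  "fbd \<alpha> 0 = (\<lambda>x. if x = 0 then 1 else 0)"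
| "fbd \<alpha> (Suc t) =
    (\<lambda>x. (free \<alpha> (fbd \<alpha> t) (x - 1) + free \<alpha> (fbd \<alpha> t) (x + 1)) / 2 + frozen \<alpha> (fbd \<alpha> t) x)"

definition fbd_boundary :: "real \<Rightarrow> nat \<Rightarrow> int" where
  "fbd_boundary \<alpha> t = boundary \<alpha> (fbd \<alpha> t)"

end

theory Submission
  imports Defs
begin

text \<open>
  Both bounds come from the second moment. A step replaces each free point mass at \<open>x\<close> by halves
  at \<open>x - 1\<close> and \<open>x + 1\<close>, and \<open>((x - 1)\<^sup>2 + (x + 1)\<^sup>2) / 2 = x\<^sup>2 + 1\<close>, while the frozen mass stays
  put. As the free mass is always \<open>1 - \<alpha>\<close>, the second moment at time \<open>t\<close> is exactly
  \<open>(1 - \<alpha>) t\<close> (\<open>second_moment_fbd\<close>).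

  For the upper bound, mass at least \<open>\<alpha>\<close> lies at distance at least \<open>\<beta>\<^sub>t\<close> from the origin, so
  \<open>\<alpha> \<beta>\<^sub>t\<^sup>2 \<le> (1 - \<alpha>) t\<close> (\<open>boundary_sq_le_second_moment\<close>). For the lower bound, the free mass lies in
  \<open>[-\<beta>\<^sub>t, \<beta>\<^sub>t]\<close> and \<open>\<beta>\<^sub>t\<close> never decreases, so by induction all mass lies in
  \<open>[-\<beta>\<^sub>t - 1, \<beta>\<^sub>t + 1]\<close> (\<open>fbd_support\<close>). Hence \<open>(1 - \<alpha>) t \<le> (\<beta>\<^sub>t + 1)\<^sup>2\<close>, and
  \<open>\<beta>\<^sub>t + 1 \<le> 2 \<beta>\<^sub>t\<close> as soon as the boundary has left \<open>0\<close>. The latter inequality also shows that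
  the boundary does leave \<open>0\<close>; by monotonicity it does so once and for all.
\<close>

section \<open>Sums of finitely supported functions on the integers\<close>

lemma infsum_atLeast_split:
  fixes g :: "int \<Rightarrow> real"
  assumes "finite {x. g x \<noteq> 0}"
  shows "infsum g {x..} = g x + infsum g {x + 1..}"
proof -
  have eq: "{x..} = insert x {x + 1..}" by auto
  have "g summable_on {x + 1..}"
    by (rule finite_nonzero_values_imp_summable_on) (rule finite_subset[OF _ assms], auto)
  then show ?thesis unfolding eq by (subst infsum_insert) auto
qed

lemma infsum_even:
  fixes g :: "int \<Rightarrow> real"
  assumes fin: "finite {x. g x \<noteq> 0}" and even: "\<And>x. g (- x) = g x"
  shows "(\<Sum>\<^sub>\<infinity>x. g x) = g 0 + 2 * infsum g {1..}"
proof -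
  have summ: "g summable_on A" for A
    by (rule finite_nonzero_values_imp_summable_on) (rule finite_subset[OF _ fin], auto)
  have bij: "bij_betw uminus {1..} {..-1::int}"
    by (rule bij_betw_byWitness[where f' = uminus]) auto
  have neg: "infsum g {..-1} = infsum g {1..}"
    using infsum_reindex_bij_betw[OF bij, of g] by (simp add: even)
  have UNIV_eq: "UNIV = insert (0::int) ({..-1} \<union> {1..})" by auto
  have "infsum g ({..-1} \<union> {1..}) = infsum g {..-1} + infsum g {1..}"
    by (intro infsum_Un_disjoint summ) auto
  then show ?thesis unfolding UNIV_eq
    by (subst infsum_insert) (auto simp: summ neg)
qed

text \<open>The neighbour average is self-adjoint; it can be moved from the mass to the test function.\<close>

lemma infsum_neighbour_average:
  fixes g h :: "int \<Rightarrow> real"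
  assumes fin: "finite {x. g x \<noteq> 0}"
  shows "(\<Sum>\<^sub>\<infinity>x. h x * ((g (x - 1) + g (x + 1)) / 2)) = (\<Sum>\<^sub>\<infinity>x. (h (x + 1) + h (x - 1)) / 2 * g x)"
proof -
  have shift: "(\<Sum>\<^sub>\<infinity>x. u (x + c)) = (\<Sum>\<^sub>\<infinity>x. u x)" for u :: "int \<Rightarrow> real" and c
    by (rule infsum_reindex_bij_betw) (rule bij_betw_byWitness[where f' = "\<lambda>x. x - c"], auto)
  have summ: "(\<lambda>x. k x * g (x + c)) summable_on UNIV" for k c
  proof (rule finite_nonzero_values_imp_summable_on, rule finite_subset)
    show "{x \<in> UNIV. k x * g (x + c) \<noteq> 0} \<subseteq> (\<lambda>x. x - c) ` {x. g x \<noteq> 0}"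
      by (auto simp: image_iff intro!: exI[of _ "_ + c"])
  qed (use fin in simp)
  have "(\<Sum>\<^sub>\<infinity>x. h x * ((g (x - 1) + g (x + 1)) / 2))
      = (\<Sum>\<^sub>\<infinity>x. h x / 2 * g (x + - 1) + h x / 2 * g (x + 1))"
    by (intro infsum_cong) (simp add: field_simps)
  also have "\<dots> = (\<Sum>\<^sub>\<infinity>x. h x / 2 * g (x + - 1)) + (\<Sum>\<^sub>\<infinity>x. h x / 2 * g (x + 1))"
    by (intro infsum_add summ)
  also have "(\<Sum>\<^sub>\<infinity>x. h x / 2 * g (x + - 1)) = (\<Sum>\<^sub>\<infinity>x. h (x + 1) / 2 * g (x + 0))"
    using shift[of "\<lambda>x. h (x + 1) / 2 * g x" "- 1"] by simp
  also have "(\<Sum>\<^sub>\<infinity>x. h x / 2 * g (x + 1)) = (\<Sum>\<^sub>\<infinity>x. h (x - 1) / 2 * g (x + 0))"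
    using shift[of "\<lambda>x. h (x - 1) / 2 * g x" 1] by simp
  also have "(\<Sum>\<^sub>\<infinity>x. h (x + 1) / 2 * g (x + 0)) + (\<Sum>\<^sub>\<infinity>x. h (x - 1) / 2 * g (x + 0))
      = (\<Sum>\<^sub>\<infinity>x. h (x + 1) / 2 * g (x + 0) + h (x - 1) / 2 * g (x + 0))"
    by (intro infsum_add[symmetric] summ)
  also have "\<dots> = (\<Sum>\<^sub>\<infinity>x. (h (x + 1) + h (x - 1)) / 2 * g x)"
    by (intro infsum_cong) (simp add: field_simps)
  finally show ?thesis .
qed

section \<open>The boundary and the frozen mass of a symmetric distribution\<close>

definition symmetric_dist :: "(int \<Rightarrow> real) \<Rightarrow> bool" where
  "symmetric_dist m \<longleftrightarrow>
     finite {x. m x \<noteq> 0} \<and> (\<forall>x. 0 \<le> m x) \<and> (\<forall>x. m (- x) = m x) \<and> (\<Sum>\<^sub>\<infinity>x. m x) = 1"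

definition second_moment :: "(int \<Rightarrow> real) \<Rightarrow> real" where
  "second_moment m = (\<Sum>\<^sub>\<infinity>x. (real_of_int x)\<^sup>2 * m x)"

locale symmetric_distribution =
  fixes \<alpha> :: real and m :: "int \<Rightarrow> real"
  assumes \<alpha>: "0 < \<alpha>" "\<alpha> < 1" and dist: "symmetric_dist m"
begin

lemma finite_support: "finite {x. m x \<noteq> 0}"
  and nonneg: "0 \<le> m x"
  and even: "m (- x) = m x"
  and total: "(\<Sum>\<^sub>\<infinity>x. m x) = 1"
  using dist by (auto simp: symmetric_dist_def)

lemma summable: "m summable_on A"
  by (rule finite_nonzero_values_imp_summable_on) (rule finite_subset[OF _ finite_support], auto)

lemma weighted_summable: "(\<lambda>x. h x * m x) summable_on A"
  by (rule finite_nonzero_values_imp_summable_on) (rule finite_subset[OF _ finite_support], auto)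

abbreviation tail :: "int \<Rightarrow> real" where
  "tail x \<equiv> infsum m {x..}"

lemma tail_step: "tail x = m x + tail (x + 1)"
  by (rule infsum_atLeast_split[OF finite_support])

lemma total_eq: "m 0 + 2 * tail 1 = 1"
  using infsum_even[OF finite_support even] total by simp

text \<open>
  The supremum that defines the boundary is attained, because the tail vanishes beyond the
  support and is at least one half at \<open>0\<close>.
\<close>

lemma boundary_properties:
  shows boundary_nonneg: "0 \<le> boundary \<alpha> m"
    and tail_boundary: "\<alpha> / 2 \<le> tail (boundary \<alpha> m)"
    and tail_after_boundary: "tail (boundary \<alpha> m + 1) < \<alpha> / 2"
    and le_boundary: "\<And>x. \<alpha> / 2 \<le> tail x \<Longrightarrow> x \<le> boundary \<alpha> m"
proof -
  define S where "S = {x. \<alpha> / 2 \<le> tail x}"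
  have "tail 0 \<ge> 1 / 2"
    using total_eq tail_step[of 0] nonneg[of 0] by simp
  then have S0: "0 \<in> S" using \<alpha> by (simp add: S_def)
  have "bdd_above {x. m x \<noteq> 0}" using finite_support by (rule bdd_above_finite)
  then obtain N where N: "\<And>x. m x \<noteq> 0 \<Longrightarrow> x \<le> N" by (auto simp: bdd_above_def)
  have le_N: "x \<le> N" if "x \<in> S" for x
  proof (rule ccontr)
    assume "\<not> x \<le> N"
    then have "m y = 0" if "y \<in> {x..}" for y using N[of y] that by fastforce
    then have "tail x = 0" by (rule infsum_0)
    with that \<alpha> show False by (simp add: S_def)
  qed
  define b where "b = Max (S \<inter> {0..N})"
  have fin: "finite (S \<inter> {0..N})" by simp
  have ne: "S \<inter> {0..N} \<noteq> {}" using S0 le_N by auto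
  have bS: "b \<in> S" "0 \<le> b" using Max_in[OF fin ne] by (auto simp: b_def)
  have max: "x \<le> b" if "x \<in> S" for x
  proof (cases "0 \<le> x")
    case True
    then show ?thesis using that le_N Max_ge[OF fin, of x] by (auto simp: b_def)
  qed (use bS in simp)
  have "boundary \<alpha> m = b"
    unfolding boundary_def S_def[symmetric] using bS(1) max by (rule cSup_eq_maximum)
  moreover have "tail (b + 1) < \<alpha> / 2"
    using max[of "b + 1"] by (force simp: S_def)
  ultimately show "0 \<le> boundary \<alpha> m" "\<alpha> / 2 \<le> tail (boundary \<alpha> m)"
    "tail (boundary \<alpha> m + 1) < \<alpha> / 2" "\<And>x. \<alpha> / 2 \<le> tail x \<Longrightarrow> x \<le> boundary \<alpha> m"
    using bS max by (auto simp: S_def)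
qed

lemma greaterThan_eq: "{z<..} = {z + 1..}" for z :: int
  by auto

lemma frozen_beyond: "boundary \<alpha> m < x \<Longrightarrow> frozen \<alpha> m x = m x"
  using boundary_nonneg by (auto simp: frozen_def Let_def)

lemma frozen_inside: "\<bar>x\<bar> < boundary \<alpha> m \<Longrightarrow> frozen \<alpha> m x = 0"
  by (auto simp: frozen_def Let_def)

lemma frozen_boundary:
  "0 < boundary \<alpha> m \<Longrightarrow> frozen \<alpha> m (boundary \<alpha> m) = \<alpha> / 2 - tail (boundary \<alpha> m + 1)"
  by (simp add: frozen_def Let_def greaterThan_eq)

lemma frozen_zero: "boundary \<alpha> m = 0 \<Longrightarrow> frozen \<alpha> m 0 = \<alpha> - 2 * tail 1"
  by (simp add: frozen_def Let_def greaterThan_eq)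

lemma frozen_even: "frozen \<alpha> m (- x) = frozen \<alpha> m x"
  by (simp add: frozen_def Let_def even)

lemma frozen_abs: "frozen \<alpha> m \<bar>x\<bar> = frozen \<alpha> m x"
  using frozen_even[of x] by (simp add: abs_if)

text \<open>
  At a positive boundary this is the definition of the boundary: the tail beyond it is below
  \<open>\<alpha> / 2\<close>, and including the boundary itself lifts the tail to at least \<open>\<alpha> / 2\<close>. At boundary \<open>0\<close> the
  upper bound is \<open>\<alpha> \<le> 1\<close>, as \<open>m 0\<close> and the two tails together make up the total mass.
\<close>

lemma frozen_bounds: "0 \<le> frozen \<alpha> m x \<and> frozen \<alpha> m x \<le> m x"
proof -
  have "m \<bar>x\<bar> = m x" using even[of x] by (simp add: abs_if)
  moreover have "0 \<le> frozen \<alpha> m \<bar>x\<bar> \<and> frozen \<alpha> m \<bar>x\<bar> \<le> m \<bar>x\<bar>"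
  proof (cases "\<bar>x\<bar> = boundary \<alpha> m")
    case True
    show ?thesis
    proof (cases "boundary \<alpha> m = 0")
      case True
      with \<open>\<bar>x\<bar> = boundary \<alpha> m\<close> show ?thesis
        using frozen_zero total_eq tail_after_boundary \<alpha> by simp
    next
      case False
      then show ?thesis
        using \<open>\<bar>x\<bar> = boundary \<alpha> m\<close> boundary_nonneg frozen_boundary tail_boundary
          tail_after_boundary tail_step[of "boundary \<alpha> m"] by simp
    qed
  next
    case False
    then consider "\<bar>x\<bar> < boundary \<alpha> m" | "boundary \<alpha> m < \<bar>x\<bar>" by linarith
    then show ?thesis
      by cases (simp_all only: frozen_beyond frozen_inside abs_idempotent nonneg order_refl simp_thms)
  qed
  ultimately show ?thesis by (simp add: frozen_abs)
qed

lemma frozen_eq_0: "m x = 0 \<Longrightarrow> frozen \<alpha> m x = 0"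
  using frozen_bounds[of x] by simp

lemma frozen_finite_support: "finite {x. frozen \<alpha> m x \<noteq> 0}"
  by (rule finite_subset[OF _ finite_support]) (auto intro: frozen_eq_0)

lemma free_finite_support: "finite {x. free \<alpha> m x \<noteq> 0}"
  by (rule finite_subset[OF _ finite_support]) (auto simp: free_def frozen_eq_0)

lemma frozen_right_tail:
  assumes "0 < boundary \<alpha> m"
  shows "infsum (frozen \<alpha> m) {boundary \<alpha> m..} = \<alpha> / 2"
proof -
  have "infsum (frozen \<alpha> m) {boundary \<alpha> m + 1..} = tail (boundary \<alpha> m + 1)"
    by (intro infsum_cong frozen_beyond) simp
  then show ?thesis
    using infsum_atLeast_split[OF frozen_finite_support, of "boundary \<alpha> m"] frozen_boundary[OF assms] by simp
qed

lemma frozen_total: "(\<Sum>\<^sub>\<infinity>x. frozen \<alpha> m x) = \<alpha>"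
proof -
  have total: "(\<Sum>\<^sub>\<infinity>x. frozen \<alpha> m x) = frozen \<alpha> m 0 + 2 * infsum (frozen \<alpha> m) {1..}"
    by (rule infsum_even[OF frozen_finite_support frozen_even])
  show ?thesis
  proof (cases "boundary \<alpha> m = 0")
    case True
    have "infsum (frozen \<alpha> m) {1..} = tail 1"
      by (intro infsum_cong frozen_beyond) (simp add: True)
    then show ?thesis using total frozen_zero[OF True] by simp
  next
    case False
    then have pos: "0 < boundary \<alpha> m" using boundary_nonneg by simp
    have "infsum (frozen \<alpha> m) {1..} = infsum (frozen \<alpha> m) {boundary \<alpha> m..}"
      using pos by (intro infsum_cong_neutral) (auto intro: frozen_inside)
    then show ?thesis using total frozen_right_tail[OF pos] frozen_inside[of 0] pos by simp
  qed
qed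

lemma frozen_weighted_summable: "(\<lambda>x. h x * frozen \<alpha> m x) summable_on A"
  by (rule finite_nonzero_values_imp_summable_on)
    (rule finite_subset[OF _ frozen_finite_support], auto)

lemma free_weighted_summable: "(\<lambda>x. h x * free \<alpha> m x) summable_on A"
  by (rule finite_nonzero_values_imp_summable_on)
    (rule finite_subset[OF _ free_finite_support], auto)

lemma free_plus_frozen:
  "(\<Sum>\<^sub>\<infinity>x. h x * free \<alpha> m x) + (\<Sum>\<^sub>\<infinity>x. h x * frozen \<alpha> m x) = (\<Sum>\<^sub>\<infinity>x. h x * m x)"
proof -
  have "(\<Sum>\<^sub>\<infinity>x. h x * free \<alpha> m x) + (\<Sum>\<^sub>\<infinity>x. h x * frozen \<alpha> m x)
      = (\<Sum>\<^sub>\<infinity>x. h x * free \<alpha> m x + h x * frozen \<alpha> m x)"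
    by (intro infsum_add[symmetric] free_weighted_summable frozen_weighted_summable)
  then show ?thesis by (simp add: free_def algebra_simps)
qed

lemma free_total: "(\<Sum>\<^sub>\<infinity>x. free \<alpha> m x) = 1 - \<alpha>"
  using free_plus_frozen[of "\<lambda>_. 1"] frozen_total total by simp

lemma free_nonneg: "0 \<le> free \<alpha> m x"
  using frozen_bounds[of x] by (simp add: free_def)

lemma free_even: "free \<alpha> m (- x) = free \<alpha> m x"
  by (simp add: free_def even frozen_even)

lemma free_support: "free \<alpha> m x \<noteq> 0 \<Longrightarrow> \<bar>x\<bar> \<le> boundary \<alpha> m"
proof (rule ccontr)
  assume free: "free \<alpha> m x \<noteq> 0" and "\<not> \<bar>x\<bar> \<le> boundary \<alpha> m"
  then have "frozen \<alpha> m \<bar>x\<bar> = m \<bar>x\<bar>" by (intro frozen_beyond) simp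
  then have "frozen \<alpha> m x = m x" using frozen_abs[of x] even[of x] by (simp add: abs_if split: if_splits)
  with free show False by (simp add: free_def)
qed

text \<open>By symmetry, mass at least \<open>\<alpha>\<close> lies at distance at least the boundary from the origin.\<close>

lemma boundary_sq_le_second_moment: "\<alpha> * (real_of_int (boundary \<alpha> m))\<^sup>2 \<le> second_moment m"
proof (cases "boundary \<alpha> m = 0")
  case True
  then show ?thesis by (auto simp: second_moment_def nonneg intro: infsum_nonneg)
next
  case False
  let ?b = "boundary \<alpha> m"
  have pos: "0 < ?b" using False boundary_nonneg by simp
  have "\<alpha> / 2 * (real_of_int ?b)\<^sup>2 \<le> (real_of_int ?b)\<^sup>2 * tail ?b"
    using mult_right_mono[OF tail_boundary, of "(real_of_int ?b)\<^sup>2"] by (simp add: mult.commute)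
  also have "\<dots> = (\<Sum>\<^sub>\<infinity>x\<in>{?b..}. (real_of_int ?b)\<^sup>2 * m x)"
    by (rule infsum_cmult_right'[symmetric])
  also have "\<dots> \<le> (\<Sum>\<^sub>\<infinity>x\<in>{?b..}. (real_of_int x)\<^sup>2 * m x)"
    using pos by (intro infsum_mono weighted_summable mult_right_mono nonneg power_mono) auto
  also have "\<dots> \<le> (\<Sum>\<^sub>\<infinity>x\<in>{1..}. (real_of_int x)\<^sup>2 * m x)"
    using pos by (intro infsum_mono2 weighted_summable) (auto simp: nonneg)
  finally have half: "\<alpha> / 2 * (real_of_int ?b)\<^sup>2 \<le> (\<Sum>\<^sub>\<infinity>x\<in>{1..}. (real_of_int x)\<^sup>2 * m x)" .
  have "finite {x. (real_of_int x)\<^sup>2 * m x \<noteq> 0}"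
    by (rule finite_subset[OF _ finite_support]) auto
  then have "second_moment m = 2 * (\<Sum>\<^sub>\<infinity>x\<in>{1..}. (real_of_int x)\<^sup>2 * m x)"
    unfolding second_moment_def by (subst infsum_even) (auto simp: even)
  with half show ?thesis by simp
qed

lemma second_moment_le_radius_sq:
  assumes "\<And>x. m x \<noteq> 0 \<Longrightarrow> \<bar>x\<bar> \<le> r"
  shows "second_moment m \<le> (real_of_int r)\<^sup>2"
proof -
  have "(real_of_int x)\<^sup>2 * m x \<le> (real_of_int r)\<^sup>2 * m x" for x
  proof (cases "m x = 0")
    case False
    then have "\<bar>real_of_int x\<bar> \<le> \<bar>real_of_int r\<bar>" using assms[of x] by linarith
    then have "(real_of_int x)\<^sup>2 \<le> (real_of_int r)\<^sup>2" by (simp only: abs_le_square_iff)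
    then show ?thesis by (intro mult_right_mono nonneg)
  qed simp
  then have "second_moment m \<le> (\<Sum>\<^sub>\<infinity>x. (real_of_int r)\<^sup>2 * m x)"
    unfolding second_moment_def by (intro infsum_mono weighted_summable)
  then show ?thesis by (simp add: infsum_cmult_right' total)
qed

section \<open>One step of the diffusion\<close>

definition step :: "int \<Rightarrow> real" where
  "step x = (free \<alpha> m (x - 1) + free \<alpha> m (x + 1)) / 2 + frozen \<alpha> m x"

lemma step_finite_support: "finite {x. step x \<noteq> 0}"
proof (rule finite_subset)
  let ?F = "{x. free \<alpha> m x \<noteq> 0}"
  show "{x. step x \<noteq> 0} \<subseteq> (\<lambda>x. x + 1) ` ?F \<union> (\<lambda>x. x - 1) ` ?F \<union> {x. frozen \<alpha> m x \<noteq> 0}"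
  proof
    fix x
    assume "x \<in> {x. step x \<noteq> 0}"
    then consider "x - 1 \<in> ?F" | "x + 1 \<in> ?F" | "frozen \<alpha> m x \<noteq> 0"
      unfolding step_def by fastforce
    then show "x \<in> (\<lambda>x. x + 1) ` ?F \<union> (\<lambda>x. x - 1) ` ?F \<union> {x. frozen \<alpha> m x \<noteq> 0}"
      by cases (force simp: image_iff intro: bexI[of _ "x - 1"] bexI[of _ "x + 1"])+
  qed
qed (simp add: free_finite_support frozen_finite_support)

text \<open>
  The test function \<open>1\<close> gives conservation of mass, and \<open>x\<^sup>2\<close> gives the growth of the second
  moment by the free mass.
\<close>

lemma infsum_step:
  "(\<Sum>\<^sub>\<infinity>x. h x * step x)
    = (\<Sum>\<^sub>\<infinity>x. (h (x + 1) + h (x - 1)) / 2 * free \<alpha> m x) + (\<Sum>\<^sub>\<infinity>x. h x * frozen \<alpha> m x)"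
proof -
  have summ: "(\<lambda>x. h x * step x) summable_on UNIV"
    by (rule finite_nonzero_values_imp_summable_on)
      (rule finite_subset[OF _ step_finite_support], auto)
  have eq: "(\<lambda>x. h x * ((free \<alpha> m (x - 1) + free \<alpha> m (x + 1)) / 2))
      = (\<lambda>x. h x * step x + - h x * frozen \<alpha> m x)"
    by (simp add: step_def field_simps)
  have "(\<Sum>\<^sub>\<infinity>x. h x * ((free \<alpha> m (x - 1) + free \<alpha> m (x + 1)) / 2))
      = (\<Sum>\<^sub>\<infinity>x. h x * step x) + (\<Sum>\<^sub>\<infinity>x. - h x * frozen \<alpha> m x)"
    unfolding eq by (intro infsum_add summ frozen_weighted_summable)
  also have "\<dots> = (\<Sum>\<^sub>\<infinity>x. h x * step x) - (\<Sum>\<^sub>\<infinity>x. h x * frozen \<alpha> m x)"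
    by (simp add: infsum_uminus)
  finally have "(\<Sum>\<^sub>\<infinity>x. h x * ((free \<alpha> m (x - 1) + free \<alpha> m (x + 1)) / 2))
      = (\<Sum>\<^sub>\<infinity>x. h x * step x) - (\<Sum>\<^sub>\<infinity>x. h x * frozen \<alpha> m x)" .
  then show ?thesis
    using infsum_neighbour_average[OF free_finite_support, of h] by simp
qed

lemma step_symmetric_dist: "symmetric_dist step"
  unfolding symmetric_dist_def
proof (intro conjI allI)
  show "0 \<le> step x" for x
    using free_nonneg[of "x - 1"] free_nonneg[of "x + 1"] frozen_bounds[of x]
    by (simp add: step_def)
  show "step (- x) = step x" for x
    using free_even[of "x - 1"] free_even[of "x + 1"]
    by (simp add: step_def frozen_even)
  show "(\<Sum>\<^sub>\<infinity>x. step x) = 1"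
    using infsum_step[of "\<lambda>_. 1"] free_total frozen_total by simp
qed (rule step_finite_support)

lemma second_moment_step: "second_moment step = second_moment m + (1 - \<alpha>)"
proof -
  let ?sq = "\<lambda>x. (real_of_int x)\<^sup>2"
  have "(\<Sum>\<^sub>\<infinity>x. (?sq (x + 1) + ?sq (x - 1)) / 2 * free \<alpha> m x)
      = (\<Sum>\<^sub>\<infinity>x. ?sq x * free \<alpha> m x + 1 * free \<alpha> m x)"
    by (intro infsum_cong) (simp add: power2_eq_square field_simps)
  also have "\<dots> = (\<Sum>\<^sub>\<infinity>x. ?sq x * free \<alpha> m x) + (\<Sum>\<^sub>\<infinity>x. 1 * free \<alpha> m x)"
    by (intro infsum_add free_weighted_summable)
  finally show ?thesis
    using infsum_step[of ?sq] free_plus_frozen[of ?sq] free_total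
    by (simp add: second_moment_def)
qed

text \<open>
  A positive boundary cannot retreat, since the frozen mass \<open>\<alpha> / 2\<close> on its right does not move.
\<close>

lemma boundary_le_boundary_step: "boundary \<alpha> m \<le> boundary \<alpha> step"
proof -
  interpret next_dist: symmetric_distribution \<alpha> step
    by unfold_locales (use \<alpha> step_symmetric_dist in auto)
  show ?thesis
  proof (cases "boundary \<alpha> m = 0")
    case True
    then show ?thesis using next_dist.boundary_nonneg by simp
  next
    case False
    then have "0 < boundary \<alpha> m" using boundary_nonneg by simp
    then have "\<alpha> / 2 = infsum (frozen \<alpha> m) {boundary \<alpha> m..}" by (simp add: frozen_right_tail)
    also have "\<dots> \<le> infsum step {boundary \<alpha> m..}"
      using frozen_weighted_summable[of "\<lambda>_. 1"] free_nonneg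
      by (intro infsum_mono next_dist.summable) (auto simp: step_def)
    finally show ?thesis by (rule next_dist.le_boundary)
  qed
qed

end

section \<open>The evolution of the diffusion\<close>

lemma fbd_symmetric_distribution:
  assumes "0 < \<alpha>" "\<alpha> < 1"
  shows "symmetric_distribution \<alpha> (fbd \<alpha> t)"
proof (induction t)
  case 0
  have "(\<Sum>\<^sub>\<infinity>x::int. if x = 0 then 1 else (0::real)) = (\<Sum>\<^sub>\<infinity>x\<in>{0::int}. 1)"
    by (rule infsum_cong_neutral) auto
  then show ?case using assms by unfold_locales (auto simp: symmetric_dist_def)
next
  case (Suc t)
  then interpret symmetric_distribution \<alpha> "fbd \<alpha> t" .
  have "fbd \<alpha> (Suc t) = step" by (simp add: step_def fun_eq_iff)
  then show ?case using \<alpha> step_symmetric_dist by unfold_locales auto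
qed

context
  fixes \<alpha> :: real
  assumes \<alpha>: "0 < \<alpha>" "\<alpha> < 1"
begin

interpretation dist: symmetric_distribution \<alpha> "fbd \<alpha> t" for t
  using \<alpha> by (rule fbd_symmetric_distribution)

lemma fbd_Suc_eq_step: "fbd \<alpha> (Suc t) = dist.step t"
  by (simp add: dist.step_def fun_eq_iff)

lemma second_moment_fbd: "second_moment (fbd \<alpha> t) = (1 - \<alpha>) * real t"
proof (induction t)
  case 0
  have "second_moment (fbd \<alpha> 0) = 0" unfolding second_moment_def by (rule infsum_0) simp
  then show ?case by simp
next
  case (Suc t)
  then show ?case
    unfolding fbd_Suc_eq_step dist.second_moment_step by (simp add: algebra_simps)
qed

lemma fbd_boundary_nonneg: "0 \<le> fbd_boundary \<alpha> t"
  unfolding fbd_boundary_def by (rule dist.boundary_nonneg)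

lemma fbd_boundary_Suc: "fbd_boundary \<alpha> t \<le> fbd_boundary \<alpha> (Suc t)"
  unfolding fbd_boundary_def fbd_Suc_eq_step by (rule dist.boundary_le_boundary_step)

text \<open>
  Mass enters a new site only from a free mass, hence from within the current boundary, which
  never retreats; so the support never extends more than one site beyond the boundary.
\<close>

lemma fbd_support: "fbd \<alpha> t x \<noteq> 0 \<Longrightarrow> \<bar>x\<bar> \<le> fbd_boundary \<alpha> t + 1"
proof (induction t arbitrary: x)
  case 0
  then have "x = 0" by (simp split: if_splits)
  then show ?case using fbd_boundary_nonneg[of 0] by simp
next
  case (Suc t)
  from Suc.prems consider
    "free \<alpha> (fbd \<alpha> t) (x - 1) \<noteq> 0" | "free \<alpha> (fbd \<alpha> t) (x + 1) \<noteq> 0" | "frozen \<alpha> (fbd \<alpha> t) x \<noteq> 0"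
    by fastforce
  then have "\<bar>x\<bar> \<le> fbd_boundary \<alpha> t + 1"
  proof cases
    case 1
    from dist.free_support[OF this] show ?thesis by (simp add: fbd_boundary_def)
  next
    case 2
    from dist.free_support[OF this] show ?thesis by (simp add: fbd_boundary_def)
  next
    case 3
    then have "fbd \<alpha> t x \<noteq> 0" using dist.frozen_bounds[of t x] by auto
    then show ?thesis by (rule Suc.IH)
  qed
  then show ?case using fbd_boundary_Suc[of t] by simp
qed

lemma fbd_boundary_sq_le: "\<alpha> * (real_of_int (fbd_boundary \<alpha> t))\<^sup>2 \<le> (1 - \<alpha>) * real t"
  using dist.boundary_sq_le_second_moment[of t] by (simp add: second_moment_fbd fbd_boundary_def)

lemma le_fbd_boundary_sq: "(1 - \<alpha>) * real t \<le> (real_of_int (fbd_boundary \<alpha> t) + 1)\<^sup>2"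
  using dist.second_moment_le_radius_sq[OF fbd_support, of t t] by (simp add: second_moment_fbd)

end

theorem lemma1:
  fixes \<alpha> :: real
  assumes "0 < \<alpha>" and "\<alpha> < 1"
  shows "\<exists>a>0. \<exists>b>0. \<exists>T. (\<forall>t<T. fbd_boundary \<alpha> t = 0) \<and>
           (\<forall>t\<ge>T. a * sqrt (real t) < real_of_int (fbd_boundary \<alpha> t) \<and>
                  real_of_int (fbd_boundary \<alpha> t) < b * sqrt (real t))"
proof -
  note nonneg = fbd_boundary_nonneg[OF assms]
  note upper = fbd_boundary_sq_le[OF assms]
  note lower = le_fbd_boundary_sq[OF assms]
  \<comment> \<open>The moment bounds hold with \<open>2\<close> in place of the divisor \<open>3\<close> and with \<open>1 - \<alpha>\<close> in place of the
    numerator \<open>2\<close>; the slack makes the inequalities strict.\<close>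
  define a where "a = sqrt (1 - \<alpha>) / 3"
  define b where "b = sqrt (2 / \<alpha>)"
  define T where "T = (LEAST t. fbd_boundary \<alpha> t \<noteq> 0)"
  obtain n where n: "1 / (1 - \<alpha>) < real n" using reals_Archimedean2 by blast
  then have "1 < (1 - \<alpha>) * real n" using assms by (simp add: field_simps)
  then have "fbd_boundary \<alpha> n \<noteq> 0" using lower[of n] by auto
  then have T: "fbd_boundary \<alpha> T \<noteq> 0" unfolding T_def by (rule LeastI)
  have before: "fbd_boundary \<alpha> t = 0" if "t < T" for t
    using not_less_Least that unfolding T_def by blast
  have after: "a * sqrt (real t) < real_of_int (fbd_boundary \<alpha> t) \<and>
      real_of_int (fbd_boundary \<alpha> t) < b * sqrt (real t)" if "T \<le> t" for t
  proof -
    let ?\<beta> = "real_of_int (fbd_boundary \<alpha> t)"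
    have "fbd_boundary \<alpha> T \<le> fbd_boundary \<alpha> t"
      using fbd_boundary_Suc[OF assms] that by (rule lift_Suc_mono_le)
    then have \<beta>: "1 \<le> ?\<beta>" using T nonneg[of T] by linarith
    then have "0 < \<alpha> * ?\<beta>\<^sup>2" using assms by (intro mult_pos_pos) auto
    then have t: "0 < real t" using upper[of t] by (cases "t = 0") auto
    have "(1 - \<alpha>) * real t \<le> (2 * ?\<beta>)\<^sup>2"
      using lower[of t] \<beta> power_mono[of "?\<beta> + 1" "2 * ?\<beta>" 2] by linarith
    also have "\<dots> < (3 * ?\<beta>)\<^sup>2" using \<beta> by (intro power_strict_mono) auto
    finally have "sqrt ((1 - \<alpha>) * real t) < 3 * ?\<beta>" using \<beta> by (intro real_less_lsqrt) auto
    then have left: "a * sqrt (real t) < ?\<beta>" by (simp add: a_def real_sqrt_mult)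
    have "\<alpha> * ?\<beta>\<^sup>2 < 2 * real t"
      using upper[of t] mult_strict_right_mono[OF _ t, of "1 - \<alpha>" 2] assms by linarith
    then have "?\<beta>\<^sup>2 < 2 / \<alpha> * real t" using assms by (simp add: field_simps)
    then have "?\<beta> < sqrt (2 / \<alpha> * real t)" by (rule real_less_rsqrt)
    then have "?\<beta> < b * sqrt (real t)" by (simp only: b_def real_sqrt_mult)
    with left show ?thesis ..
  qed
  have "0 < a" "0 < b" using assms by (auto simp: a_def b_def)
  with before after show ?thesis by blast
qed

end
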